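(* Let $p\geq 3$ be a prime. Then $\mathrm{rb}(\mathbb{Z}_p,S)=4$.
   Context: For a positive integer $n$, $\mathbb{Z}_n$ is the cyclic group of integers modulo $n$. An $r$-coloring of a set $X$ is a function $c:X\to\{1,\dots,r\}$; it is exact if $c$ is surjective. $S$ denotes the Sidon equation $x_1+x_2=x_3+x_4$. Given a coloring $c$ of $\mathbb{Z}_n$, a rainbow solution to $S$ is a quadruple $(x_1,x_2,x_3,x_4)\in\mathbb{Z}_n^4$ with $x_1+x_2=x_3+x_4$ such that the four colors $c(x_1),c(x_2),c(x_3),c(x_4)$ are pairwise distinct. The rainbow number $\mathrm{rb}(\mathbb{Z}_n,S)$ is the smallest positive integer $r$ such that every exact $r$-coloring of $\mathbb{Z}_n$ has a rainbow solution to $S$; by convention, if no $r\le n$ has this property, then $\mathrm{rb}(\mathbb{Z}_n,S)=n+1$ (so, e.g., $\mathrm{rb}(\mathbb{Z}_2,S)=3$ and $\mathrm{rb}(\mathbb{Z}_3,S)=4$). *)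

theory Defs
  imports "HOL-Algebra.Elementary_Groups" "HOL-Computational_Algebra.Primes"
begin

text \<open>
  The group \<open>\<int>\<^sub>n\<close> is the library's \<^const>\<open>integer_mod_group\<close>, whose operation is written
  multiplicatively although it is addition modulo \<open>n\<close>; for positive \<open>n\<close> its carrier is
  \<open>{0..<int n}\<close>.
\<close>

definition exact_coloring :: "nat \<Rightarrow> 'a set \<Rightarrow> ('a \<Rightarrow> nat) \<Rightarrow> bool" where
  "exact_coloring r X c \<longleftrightarrow> c \<in> X \<rightarrow> {1..r} \<and> c ` X = {1..r}"

definition sidon_solution :: "nat \<Rightarrow> int \<Rightarrow> int \<Rightarrow> int \<Rightarrow> int \<Rightarrow> bool" where
  "sidon_solution n x1 x2 x3 x4 \<longleftrightarrow>
     {x1, x2, x3, x4} \<subseteq> carrier (integer_mod_group n) \<and>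
     x1 \<otimes>\<^bsub>integer_mod_group n\<^esub> x2 = x3 \<otimes>\<^bsub>integer_mod_group n\<^esub> x4"

definition has_rainbow_solution :: "nat \<Rightarrow> (int \<Rightarrow> nat) \<Rightarrow> bool" where
  "has_rainbow_solution n c \<longleftrightarrow>
     (\<exists>x1 x2 x3 x4. sidon_solution n x1 x2 x3 x4 \<and> distinct [c x1, c x2, c x3, c x4])"

definition rainbow_forcing :: "nat \<Rightarrow> nat \<Rightarrow> bool" where
  "rainbow_forcing n r \<longleftrightarrow>
     (\<forall>c. exact_coloring r (carrier (integer_mod_group n)) c \<longrightarrow> has_rainbow_solution n c)"

text \<open>
  Only positive \<open>n\<close> is meaningful here.  Every \<open>r > n\<close> is vacuously forcing, since there is
  no exact \<open>r\<close>-coloring of \<open>\<int>\<^sub>n\<close>; the value \<open>n + 1\<close> is the convention for the case that no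
  \<open>r \<le> n\<close> is forcing.
\<close>

definition rb_sidon :: "nat \<Rightarrow> nat" where
  "rb_sidon n =
     (if \<exists>r\<in>{1..n}. rainbow_forcing n r
      then (LEAST r. 1 \<le> r \<and> rainbow_forcing n r)
      else n + 1)"

end

theory Submission
  imports Defs "HOL-Number_Theory.Cong"
begin

text \<open>
  Suppose \<open>c\<close> colors \<open>\<int>\<^sub>p\<close> with exactly four colors and without a rainbow solution. For a step
  \<open>d \<noteq> 0\<close> consider the graph on the colors whose edges are the pairs of colors occurring at
  distance \<open>d\<close>. It is connected because \<open>d\<close> generates \<open>\<int>\<^sub>p\<close>, and it has no perfect matching
  because \<open>x - y = z - w\<close> has no rainbow solution; hence it is a star. Coloring the edge \<open>xy\<close> of
  the complete graph on \<open>\<int>\<^sub>p\<close> by the center of the star of \<open>y - x\<close> produces no rainbow triangle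
  and uses at least three colors, each of which spans a connected graph. This contradicts
  Gallai's theorem on colorings without rainbow triangles.
\<close>

section \<open>Gallai colorings\<close>

text \<open>Connectedness of the graph of \<open>k\<close>-colored edges, stated by cuts instead of
  paths: a cut without \<open>k\<close>-colored edges is what translation by a generator of the
  group rules out directly.\<close>

definition color_connected :: "('a \<Rightarrow> 'a \<Rightarrow> 'b) \<Rightarrow> 'a set \<Rightarrow> 'b \<Rightarrow> bool" where
  "color_connected f V k \<longleftrightarrow>
     (\<forall>X. X \<subseteq> V \<longrightarrow> X \<noteq> {} \<longrightarrow> X \<noteq> V \<longrightarrow> (\<exists>x\<in>X. \<exists>y\<in>V - X. f x y = k))"

lemma color_connectedD:
  assumes "color_connected f V k" "X \<subseteq> V" "X \<noteq> {}" "X \<noteq> V"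
  obtains x y where "x \<in> X" "y \<in> V" "y \<notin> X" "f x y = k"
  using assms unfolding color_connected_def by blast

text \<open>Inductive step for Gallai's theorem. Without \<open>v\<close>, color \<open>a\<close>
  splits \<open>W\<close> into several components, each joined to \<open>v\<close> in color
  \<open>a\<close>. If \<open>f v u\<close> differs from \<open>a\<close>, then \<open>u\<close>
  sends the color \<open>f v u\<close> to all other components; hence neighbors of \<open>v\<close>
  in colors \<open>b\<close> and \<open>c\<close> clash.\<close>

lemma color_disconnected_of_Gallai_insert:
  assumes sym: "\<And>x y. x \<in> V \<Longrightarrow> y \<in> V \<Longrightarrow> x \<noteq> y \<Longrightarrow> f x y = f y x"
    and gallai: "\<And>x y z. \<lbrakk>x \<in> V; y \<in> V; z \<in> V; distinct [x, y, z]\<rbrakk>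
      \<Longrightarrow> \<not> distinct [f x y, f y z, f x z]"
    and V: "V = insert v W" "v \<notin> W"
    and disc: "\<not> color_connected f W a"
    and abc: "distinct [a, b, c]"
    and conn: "color_connected f V a" "color_connected f V b" "color_connected f V c"
  shows False
proof -
  obtain S where S: "S \<subseteq> W" "S \<noteq> {}" "S \<noteq> W"
    and S': "\<And>x y. x \<in> S \<Longrightarrow> y \<in> W - S \<Longrightarrow> f x y \<noteq> a"
    using disc unfolding color_connected_def by blast
  \<comment> \<open>The classes of \<open>E\<^sup>*\<close> on \<open>W\<close> are the components
    of color \<open>a\<close>.\<close>
  define E where "E = {(x, y). x \<in> W \<and> y \<in> W \<and> x \<noteq> y \<and> f x y = a}"
  have symE: "sym E" unfolding sym_def E_def using sym V by auto
  have symE': "(y, x) \<in> E\<^sup>*" if "(x, y) \<in> E\<^sup>*" for x y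
    using that sym_rtrancl[OF symE] by (meson symD)
  have inW: "y \<in> W" if "(x, y) \<in> E\<^sup>*" "x \<in> W" for x y
    using that by (induction rule: rtrancl_induct) (auto simp: E_def)
  have noE: "f x y \<noteq> a" if "x \<in> W" "y \<in> W" "(x, y) \<notin> E\<^sup>*" for x y
  proof -
    have "x \<noteq> y" using that by auto
    then show ?thesis using that unfolding E_def by blast
  qed
  \<comment> \<open>For an \<open>a\<close>-colored edge from \<open>u\<close> to \<open>w\<close>,
    the two sides at \<open>y\<close> avoid \<open>a\<close>, so the triangle forces them to
    agree.\<close>
  have const: "f y x' = f y x" if "(x, x') \<in> E\<^sup>*" "x \<in> W" "y \<in> W" "(x, y) \<notin> E\<^sup>*" for x x' y
    using that(1)
  proof (induction rule: rtrancl_induct)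
    case (step u w)
    have uw: "u \<in> W" "w \<in> W" "u \<noteq> w" "f u w = a" using step.hyps by (auto simp: E_def)
    have xw: "(x, w) \<in> E\<^sup>*" using step.hyps by simp
    have ny: "(y, u) \<notin> E\<^sup>*" "(y, w) \<notin> E\<^sup>*"
      using that step.hyps(1) xw by (meson rtrancl_trans symE')+
    have "f y u \<noteq> a" "f y w \<noteq> a" using noE[OF that(3)] uw ny by auto
    moreover have "y \<noteq> u" "y \<noteq> w" using ny by auto
    ultimately have "f y u = f y w"
      using gallai[of y u w] that(3) uw V by auto
    then show ?case using step.IH by simp
  qed simp
  \<comment> \<open>\<open>S\<close> is a union of components, so there are at least two of
    them.\<close>
  have ex_other: "\<exists>z\<in>W. (x, z) \<notin> E\<^sup>*" if "x \<in> W" for x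
  proof (rule ccontr)
    assume *: "\<not> ?thesis"
    obtain s t where st: "s \<in> S" "t \<in> W" "t \<notin> S" using S by blast
    have "(s, t) \<in> E\<^sup>*" using * st S(1) that by (meson rtrancl_trans subsetD symE')
    then have "t \<in> S"
      using st(1)
    proof (induction rule: rtrancl_induct)
      case (step u w)
      then show ?case using S'[of u w] by (auto simp: E_def)
    qed
    then show False using st by simp
  qed
  \<comment> \<open>On \<open>V\<close> some \<open>a\<close>-colored edge leaves the component of
    \<open>y\<close>; inside \<open>W\<close> none does, so this edge ends in
    \<open>v\<close>.\<close>
  have ex_a: "\<exists>w. (y, w) \<in> E\<^sup>* \<and> f v w = a" if "y \<in> W" for y
  proof -
    have sub: "{w. (y, w) \<in> E\<^sup>*} \<subseteq> W" using inW that by auto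
    obtain w t where w: "(y, w) \<in> E\<^sup>*" "t \<in> V" "(y, t) \<notin> E\<^sup>*" "f w t = a"
      using color_connectedD[OF conn(1), of "{w. (y, w) \<in> E\<^sup>*}"] sub V by blast
    have wW: "w \<in> W" and wt: "(w, t) \<notin> E\<^sup>*"
      using w(1,3) sub by (blast, meson rtrancl_trans)
    have "t \<notin> W" using noE[OF wW _ wt] w(4) by blast
    then have "t = v" using w V by simp
    then have "f v w = a" using sym[of v w] w(4) wW V by auto
    then show ?thesis using w(1) by blast
  qed
  \<comment> \<open>Choose \<open>w\<close> in the component of \<open>y\<close> with
    \<open>f v w = a\<close>. The triangle on \<open>v\<close>, \<open>u\<close>, \<open>w\<close>
    forces \<open>f u w = f v u\<close>, and \<open>const\<close> transfers this to
    \<open>y\<close>.\<close>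
  have color_out: "f u y = f v u" if "u \<in> W" "y \<in> W" "(u, y) \<notin> E\<^sup>*" "f v u \<noteq> a" for u y
  proof -
    obtain w where w: "(y, w) \<in> E\<^sup>*" "f v w = a" using ex_a[OF \<open>y \<in> W\<close>] by blast
    have wW: "w \<in> W" using inW w that by blast
    have "(u, w) \<notin> E\<^sup>*" using w that by (meson rtrancl_trans symE')
    then have "f u w \<noteq> a" "u \<noteq> w" using noE that wW by auto
    moreover have "v \<noteq> u" "v \<noteq> w" using V(2) that(1) wW by auto
    ultimately have "f u w = f v u"
      using gallai[of v u w] that(1,4) w(2) wW V by auto
    moreover have "f u w = f u y" using const[OF w(1)] that symE' by blast
    ultimately show ?thesis by simp
  qed
  have ex_edge: "\<exists>u\<in>W. f v u = k" if "color_connected f V k" for k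
    using color_connectedD[OF that, of "{v}"] V S by blast
  obtain u w where u: "u \<in> W" "f v u = b" and w: "w \<in> W" "f v w = c"
    using ex_edge conn by meson
  \<comment> \<open>If \<open>u\<close> and \<open>w\<close> share a component, a vertex
    \<open>z\<close> outside it sees both \<open>b\<close> and \<open>c\<close> there, against
    \<open>const\<close>. Otherwise the edge between \<open>u\<close> and \<open>w\<close> would
    have both colors.\<close>
  show False
  proof (cases "(u, w) \<in> E\<^sup>*")
    case True
    obtain z where z: "z \<in> W" "(u, z) \<notin> E\<^sup>*" using ex_other u by blast
    have wz: "(w, z) \<notin> E\<^sup>*" using True z by (meson rtrancl_trans)
    have "f u z = b" "f w z = c" using color_out u w z wz abc by auto
    moreover have "f z w = f z u" using const[OF True] u z by blast
    moreover have "z \<noteq> u" "z \<noteq> w" using z wz by auto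
    ultimately show False using sym[of z u] sym[of z w] u w z V abc by auto
  next
    case False
    then have "(w, u) \<notin> E\<^sup>*" "u \<noteq> w" using symE' by auto
    then have "f u w = b" "f w u = c" using color_out False u w abc by auto
    then show False using sym[of u w] u w V abc \<open>u \<noteq> w\<close> by auto
  qed
qed

text \<open>Induction on the vertices: after deletion of \<open>v\<close> one of the three colors is
  disconnected, and the previous lemma applies with that color in the role of
  \<open>a\<close>.\<close>

theorem Gallai_color_disconnected:
  assumes "finite V" "card V \<ge> 2"
    and "\<And>x y. x \<in> V \<Longrightarrow> y \<in> V \<Longrightarrow> x \<noteq> y \<Longrightarrow> f x y = f y x"
    and "\<And>x y z. \<lbrakk>x \<in> V; y \<in> V; z \<in> V; distinct [x, y, z]\<rbrakk>
      \<Longrightarrow> \<not> distinct [f x y, f y z, f x z]"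
    and "distinct [a, b, c]"
  shows "\<not> (color_connected f V a \<and> color_connected f V b \<and> color_connected f V c)"
  using assms
proof (induction V rule: finite_induct)
  case (insert v W)
  show ?case
  proof
    assume *: "color_connected f (insert v W) a \<and> color_connected f (insert v W) b \<and>
      color_connected f (insert v W) c"
    show False
    proof (cases "card W \<ge> 2")
      case True
      have "\<not> (color_connected f W a \<and> color_connected f W b \<and> color_connected f W c)"
        using insert.prems by (intro insert.IH True) auto
      then consider "\<not> color_connected f W a" | "\<not> color_connected f W b"
        | "\<not> color_connected f W c" by blast
      then show False
      proof cases
        case 1
        show False
          by (rule color_disconnected_of_Gallai_insert[of "insert v W" f v W a b c])
            (use 1 * insert in auto)
      next
        case 2
        show False
          by (rule color_disconnected_of_Gallai_insert[of "insert v W" f v W b a c])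
            (use 2 * insert in auto)
      next
        case 3
        show False
          by (rule color_disconnected_of_Gallai_insert[of "insert v W" f v W c a b])
            (use 3 * insert in auto)
      qed
    next
      \<comment> \<open>On two vertices, the single edge would need all three colors.\<close>
      case False
      then have "card W = 1" using insert by auto
      then obtain w where w: "W = {w}" by (rule card_1_singletonE)
      have "f v w = k" if "color_connected f (insert v W) k" for k
        using color_connectedD[OF that, of "{v}"] w insert.hyps by blast
      then have "f v w = a" "f v w = b" using * by blast+
      then show False using insert.prems(4) by simp
    qed
  qed
qed simp

section \<open>Periodic colorings of the integers\<close>

text \<open>As \<open>d\<close> is invertible modulo \<open>n\<close>, the progression
  \<open>s\<close>, \<open>s + d\<close>, \<open>s + 2 * d\<close>, ... meets every residue
  class.\<close>

lemma periodic_set_eq_UNIV: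
  fixes S :: "int set" and n d :: int
  assumes "coprime d n"
    and periodic: "\<And>x y. x mod n = y mod n \<Longrightarrow> x \<in> S \<longleftrightarrow> y \<in> S"
    and s: "s \<in> S" and step: "\<And>x. x \<in> S \<Longrightarrow> x + d \<in> S" and n: "n > 0"
  shows "t \<in> S"
proof -
  have mult: "s + int k * d \<in> S" for k
  proof (induction k)
    case (Suc k)
    then show ?case using step[of "s + int k * d"] by (simp add: algebra_simps)
  qed (use s in simp)
  obtain u where u: "[d * u = 1] (mod n)"
    using cong_solve_coprime_int[OF assms(1)] by blast
  \<comment> \<open>Closure holds for forward steps only, so the number of steps is the nonnegative
    residue of \<open>(t - s) / d\<close>.\<close>
  define k where "k = nat ((u * (t - s)) mod n)"
  have k: "int k = (u * (t - s)) mod n" using n by (simp add: k_def)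
  have "[s + int k * d = s + u * (t - s) * d] (mod n)"
    unfolding k by (intro cong_add cong_mult) auto
  also have "s + u * (t - s) * d = s + (d * u) * (t - s)" by (simp add: algebra_simps)
  also have "[s + (d * u) * (t - s) = s + 1 * (t - s)] (mod n)"
    by (intro cong_add cong_mult u) auto
  finally have "(s + int k * d) mod n = t mod n" by (simp add: cong_def)
  then show ?thesis using periodic mult by blast
qed

text \<open>The graph of distinct color pairs at distance \<open>d\<close> is exactly the star with
  center \<open>m\<close> and three leaves: no edge avoids \<open>m\<close>, and every edge at
  \<open>m\<close> occurs. Sets of two colors make the edges undirected.\<close>

definition star_center :: "(int \<Rightarrow> nat) \<Rightarrow> int \<Rightarrow> nat \<Rightarrow> bool" where
  "star_center c d m \<longleftrightarrow> m \<in> {1..4} \<and>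
     (\<forall>x. c x = c (x + d) \<or> c x = m \<or> c (x + d) = m) \<and>
     (\<forall>i\<in>{1..4} - {m}. \<exists>x. {c x, c (x + d)} = {i, m})"

lemma star_centerD:
  assumes "star_center c d m"
  shows "m \<in> {1..4}" "c x = c (x + d) \<or> c x = m \<or> c (x + d) = m"
    "i \<in> {1..4} \<Longrightarrow> i \<noteq> m \<Longrightarrow> \<exists>x. {c x, c (x + d)} = {i, m}"
  using assms unfolding star_center_def by blast+

text \<open>With two centers, the edge from a third color \<open>i\<close> to \<open>m'\<close>
  would avoid \<open>m\<close>.\<close>

lemma star_center_unique:
  assumes "star_center c d m" "star_center c d m'"
  shows "m = m'"
proof (rule ccontr)
  assume "m \<noteq> m'"
  obtain i :: nat where i: "i \<in> {1..4}" "i \<noteq> m" "i \<noteq> m'"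
    using that[of 1] that[of 2] that[of 3] by fastforce
  obtain x where "{c x, c (x + d)} = {i, m'}" using star_centerD(3)[OF assms(2) i(1,3)] by blast
  then show False using star_centerD(2)[OF assms(1), of x] i \<open>m \<noteq> m'\<close>
    by (auto simp: doubleton_eq_iff)
qed

lemma star_center_uminus:
  assumes "star_center c d m"
  shows "star_center c (- d) m"
  unfolding star_center_def
proof (intro conjI allI ballI)
  fix x
  show "c x = c (x + - d) \<or> c x = m \<or> c (x + - d) = m"
    using star_centerD(2)[OF assms, of "x - d"] by auto
next
  fix i :: nat assume "i \<in> {1..4} - {m}"
  then obtain x where "{c x, c (x + d)} = {i, m}" using star_centerD(3)[OF assms] by blast
  then have "{c (x + d), c (x + d + - d)} = {i, m}" by (simp add: insert_commute)
  then show "\<exists>x. {c x, c (x + - d)} = {i, m}" by blast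
qed (use star_centerD(1)[OF assms] in simp)

text \<open>Let \<open>i\<close> be the fourth color and take points colored \<open>i\<close> and
  \<open>m\<close> at distance \<open>d + e\<close>. The point between them has the color of the
  first or \<open>k\<close>, and also the color of the last or \<open>l\<close>; these options are
  disjoint.\<close>

lemma star_center_triangle:
  assumes d: "star_center c d k" and e: "star_center c e l" and de: "star_center c (d + e) m"
  shows "\<not> distinct [k, l, m]"
proof
  assume dist: "distinct [k, l, m]"
  obtain i :: nat where i: "i \<in> {1..4}" "i \<noteq> k" "i \<noteq> l" "i \<noteq> m"
    using that[of 1] that[of 2] that[of 3] that[of 4] by fastforce
  obtain x where x: "{c x, c (x + d + e)} = {i, m}"
    using star_centerD(3)[OF de i(1,4)] by (auto simp: add.assoc)
  show False
    using star_centerD(2)[OF d, of x] star_centerD(2)[OF e, of "x + d"] x i dist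
    by (auto simp: doubleton_eq_iff)
qed

text \<open>A connected graph on four vertices without a perfect matching is a star.\<close>

lemma star_center_exists:
  fixes c :: "int \<Rightarrow> nat" and n d :: int
  assumes n: "n > 0" and cop: "coprime d n"
    and periodic: "\<And>x y. x mod n = y mod n \<Longrightarrow> c x = c y"
    and range: "range c = {1..4}"
    and no_rainbow: "\<And>x1 x2 x3 x4. x1 + x2 = x3 + x4 \<Longrightarrow> \<not> distinct [c x1, c x2, c x3, c x4]"
  shows "\<exists>m. star_center c d m"
proof -
  define E where "E i j \<longleftrightarrow> (\<exists>x. {c x, c (x + d)} = {i, j})" for i j
  have sym: "E i j \<longleftrightarrow> E j i" for i j by (simp add: E_def insert_commute)
  have no_matching: "\<not> (E i j \<and> E k l)" if "distinct [i, j, k, l]" for i j k l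
  proof
    assume "E i j \<and> E k l"
    then obtain x y where "{c x, c (x + d)} = {i, j}" "{c y, c (y + d)} = {k, l}"
      unfolding E_def by blast
    \<comment> \<open>Two disjoint edges give the solution
      \<open>x + (y + d) = (x + d) + y\<close>.\<close>
    then show False using no_rainbow[of x "y + d" "x + d" y] that
      by (auto simp: doubleton_eq_iff)
  qed
  \<comment> \<open>A union of color classes that no edge leaves is closed under adding
    \<open>d\<close>, hence everything.\<close>
  have cut: "\<exists>i\<in>T. \<exists>j\<in>{1..4} - T. E i j" if T: "T \<subseteq> {1..4}" "T \<noteq> {}" "T \<noteq> {1..4}" for T
  proof (rule ccontr)
    assume *: "\<not> ?thesis"
    have step: "c (x + d) \<in> T" if "c x \<in> T" for x
      using * that range unfolding E_def by blast
    have "T \<subseteq> range c" using T(1) range by simp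
    then obtain s where s: "c s \<in> T" using T(2) by blast
    have "x \<in> {x. c x \<in> T} \<longleftrightarrow> y \<in> {x. c x \<in> T}" if "x mod n = y mod n" for x y
      using periodic[OF that] by simp
    then have "t \<in> {x. c x \<in> T}" for t
      by (rule periodic_set_eq_UNIV[OF cop _ _ _ n]) (use s step in auto)
    then have "range c \<subseteq> T" by auto
    then show False using T range by simp
  qed
  have set4: "{1..4} = {1, 2, 3, 4::nat}" by auto
  have cut4: "\<exists>i\<in>T. \<exists>j\<in>{1, 2, 3, 4} - T. E i j"
    if "T \<subseteq> {1, 2, 3, 4}" "i \<in> T" "j \<in> {1, 2, 3, 4}" "j \<notin> T" for T i j
    using cut[of T] that unfolding set4 by blast
  \<comment> \<open>Up to complement these are all seven cuts of four colors; with the three perfect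
    matchings the claim becomes propositional.\<close>
  have cuts: "E 1 2 \<or> E 1 3 \<or> E 1 4" "E 2 1 \<or> E 2 3 \<or> E 2 4" "E 3 1 \<or> E 3 2 \<or> E 3 4"
    "E 4 1 \<or> E 4 2 \<or> E 4 3" "E 1 3 \<or> E 1 4 \<or> E 2 3 \<or> E 2 4"
    "E 1 2 \<or> E 1 4 \<or> E 3 2 \<or> E 3 4" "E 1 2 \<or> E 1 3 \<or> E 4 2 \<or> E 4 3"
    using cut4[of "{1}" 1 2] cut4[of "{2}" 2 1] cut4[of "{3}" 3 1] cut4[of "{4}" 4 1]
      cut4[of "{1, 2}" 1 3] cut4[of "{1, 3}" 1 2] cut4[of "{1, 4}" 1 2]
    by (simp_all add: insert_Diff_if)
  have matchings: "\<not> (E 1 2 \<and> E 3 4)" "\<not> (E 1 3 \<and> E 2 4)" "\<not> (E 1 4 \<and> E 2 3)"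
    by (intro no_matching; simp)+
  have "\<exists>m\<in>{1, 2, 3, 4}. (\<forall>i\<in>{1, 2, 3, 4} - {m}. E i m) \<and>
    (\<forall>i\<in>{1, 2, 3, 4} - {m}. \<forall>j\<in>{1, 2, 3, 4} - {m}. i \<noteq> j \<longrightarrow> \<not> E i j)"
    using cuts matchings
    by (simp add: insert_Diff_if sym[of 2 "Suc 0"] sym[of 3 "Suc 0"] sym[of 4 "Suc 0"]
      sym[of 3 2] sym[of 4 2] sym[of 4 3]) argo
  then obtain m where m: "m \<in> {1..4}" "\<And>i. i \<in> {1..4} - {m} \<Longrightarrow> E i m"
    "\<And>i j. \<lbrakk>i \<in> {1..4} - {m}; j \<in> {1..4} - {m}; i \<noteq> j\<rbrakk> \<Longrightarrow> \<not> E i j"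
    unfolding set4 by blast
  have "c x = c (x + d) \<or> c x = m \<or> c (x + d) = m" for x
    using m(3)[of "c x" "c (x + d)"] range unfolding E_def by blast
  then show ?thesis using m(1,2) unfolding star_center_def E_def by blast
qed

lemma rainbow_sidon_periodic:
  fixes c :: "int \<Rightarrow> nat" and p :: nat
  assumes p: "prime p"
    and periodic: "\<And>x y. x mod int p = y mod int p \<Longrightarrow> c x = c y"
    and range: "range c = {1..4}"
  shows "\<exists>x1 x2 x3 x4. x1 + x2 = x3 + x4 \<and> distinct [c x1, c x2, c x3, c x4]"
proof (rule ccontr)
  assume "\<not> ?thesis"
  then have no_rainbow: "\<And>x1 x2 x3 x4. x1 + x2 = x3 + x4 \<Longrightarrow> \<not> distinct [c x1, c x2, c x3, c x4]"
    by blast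
  have p0: "int p > 0" using prime_gt_0_nat[OF p] by simp
  have cop: "coprime d (int p)" if "\<not> int p dvd d" for d
    using that p prime_imp_coprime[of "int p" d] by (simp add: coprime_commute)
  \<comment> \<open>By uniqueness of the center the choice is immaterial for \<open>d\<close> not
    divisible by \<open>p\<close>; only such values of \<open>m\<close> matter below.\<close>
  define m where "m d = (SOME k. star_center c d k)" for d
  have m: "star_center c d (m d)" if "\<not> int p dvd d" for d
    unfolding m_def
    by (rule someI_ex, rule star_center_exists[OF p0 cop[OF that] periodic range no_rainbow])
  define V where "V = {0..<int p}"
  define f where "f x y = m (y - x)" for x y :: int
  have ndvd: "\<not> int p dvd y - x" if "x \<in> V" "y \<in> V" "x \<noteq> y" for x y
    using that unfolding V_def by (auto simp flip: mod_eq_dvd_iff)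
  have sym: "f x y = f y x" if "x \<in> V" "y \<in> V" "x \<noteq> y" for x y
    using star_center_unique[OF star_center_uminus[OF m[OF ndvd[OF that]]]]
      m[OF ndvd[OF that(2,1) that(3)[symmetric]]] unfolding f_def by simp
  have gallai: "\<not> distinct [f x y, f y z, f x z]"
    if "x \<in> V" "y \<in> V" "z \<in> V" "distinct [x, y, z]" for x y z
    unfolding f_def
    by (rule star_center_triangle[of c "y - x" _ "z - y"])
      (use that m ndvd in auto)
  \<comment> \<open>The edges of difference congruent to \<open>d\<close> all get color
    \<open>m d\<close>, and they alone connect \<open>V\<close>.\<close>
  have conn: "color_connected f V (m d)" if d: "\<not> int p dvd d" for d
    unfolding color_connected_def
  proof (intro allI impI)
    fix X assume X: "X \<subseteq> V" "X \<noteq> {}" "X \<noteq> V"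
    show "\<exists>x\<in>X. \<exists>y\<in>V - X. f x y = m d"
    proof (rule ccontr)
      assume *: "\<not> ?thesis"
      have step: "(x + d) mod int p \<in> X" if "x mod int p \<in> X" for x
      proof (rule ccontr)
        define x' y where "x' = x mod int p" and "y = (x + d) mod int p"
        assume out: "\<not> ?thesis"
        have yV: "y \<in> V" using p0 by (simp add: y_def V_def)
        have x'V: "x' \<in> V" using p0 by (simp add: x'_def V_def)
        have nd: "\<not> int p dvd y - x'"
          using ndvd[OF x'V yV] that out unfolding x'_def y_def by metis
        have "(y - x') mod int p = d mod int p"
          unfolding x'_def y_def by (simp add: mod_diff_eq)
        then have "c (u + (y - x')) = c (u + d)" for u
          by (intro periodic mod_add_cong) simp_all
        \<comment> \<open>Being a center depends only on the step modulo \<open>p\<close>, so the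
          choice in \<open>m\<close> returns the same value for both steps.\<close>
        then have "star_center c (y - x') = star_center c d"
          unfolding star_center_def by (intro ext) simp
        then have "f x' y = m d" unfolding f_def m_def by simp
        then show False using * that out yV unfolding x'_def y_def by blast
      qed
      obtain s where s: "s \<in> X" using X by blast
      have all: "t \<in> {x. x mod int p \<in> X}" for t
        by (rule periodic_set_eq_UNIV[OF cop[OF d] _ _ _ p0, of "{x. x mod int p \<in> X}" s])
          (use s X step in \<open>auto simp: V_def\<close>)
      have "V \<subseteq> X"
      proof
        fix t assume "t \<in> V"
        then show "t \<in> X" using all[of t] by (simp add: V_def)
      qed
      then show False using X by blast
    qed
  qed
  \<comment> \<open>Points colored \<open>i\<close> and \<open>j\<close> form an edge of the star
    for their difference, so its center is \<open>i\<close> or \<open>j\<close>. Hence at most one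
    of the four colors fails to be connected, which leaves three for Gallai's theorem.\<close>
  have pair: "color_connected f V i \<or> color_connected f V j"
    if ij: "i \<in> {1..4}" "j \<in> {1..4}" "i \<noteq> j" for i j
  proof -
    obtain x y where xy: "c x = i" "c y = j" using ij range by (metis imageE)
    have "\<not> int p dvd y - x"
      using periodic[of y x] xy ij by (auto simp flip: mod_eq_dvd_iff)
    then show ?thesis using star_centerD(2)[OF m, of "y - x" x] conn xy ij by auto
  qed
  have "card V \<ge> 2" using prime_ge_2_nat[OF p] by (simp add: V_def)
  then have not_three: "\<not> (color_connected f V i \<and> color_connected f V j \<and> color_connected f V k)"
    if "distinct [i, j, k]" for i j k
    by (intro Gallai_color_disconnected sym gallai that) (auto simp: V_def)
  show False
    using pair[of 1 2] pair[of 1 3] pair[of 1 4] pair[of 2 3] pair[of 2 4] pair[of 3 4]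
      not_three[of 1 2 3] not_three[of 1 2 4] not_three[of 1 3 4] not_three[of 2 3 4]
    by simp argo
qed

section \<open>The rainbow number\<close>

lemma rainbow_forcing_4:
  assumes "prime p"
  shows "rainbow_forcing p 4"
  unfolding rainbow_forcing_def
proof (intro allI impI)
  fix c assume c: "exact_coloring 4 (carrier (integer_mod_group p)) c"
  have p0: "p > 0" using prime_gt_0_nat[OF assms] .
  have carrier: "carrier (integer_mod_group p) = {0..<int p}"
    using p0 by (simp add: carrier_integer_mod_group)
  \<comment> \<open>Lifting to the integers replaces the group operation by plain addition; a
    solution found there is reduced modulo \<open>p\<close> again.\<close>
  define c' where "c' x = c (x mod int p)" for x
  have "range (\<lambda>x. x mod int p) = {0..<int p}"
  proof
    show "{0..<int p} \<subseteq> range (\<lambda>x. x mod int p)"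
    proof
      fix x assume "x \<in> {0..<int p}"
      then have "x = x mod int p" by simp
      then show "x \<in> range (\<lambda>x. x mod int p)" by (rule range_eqI)
    qed
  qed (use p0 in auto)
  then have range: "range c' = {1..4}"
    using c carrier image_image[of c "\<lambda>x. x mod int p" UNIV]
    unfolding exact_coloring_def c'_def by simp
  obtain x1 x2 x3 x4 where x: "x1 + x2 = x3 + x4" "distinct [c' x1, c' x2, c' x3, c' x4]"
    using rainbow_sidon_periodic[OF assms _ range] unfolding c'_def by auto
  have "sidon_solution p (x1 mod int p) (x2 mod int p) (x3 mod int p) (x4 mod int p)"
    using x(1) p0 unfolding sidon_solution_def carrier
    by (simp add: mult_integer_mod_group mod_add_eq)
  then show "has_rainbow_solution p c"
    using x(2) unfolding has_rainbow_solution_def c'_def by blast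
qed

text \<open>Four distinct colors are impossible with \<open>r\<close> at most 3; what remains is
  that an exact coloring exists.\<close>

lemma not_rainbow_forcing_le_3:
  assumes "1 \<le> r" "r \<le> 3" "r \<le> n"
  shows "\<not> rainbow_forcing n r"
proof
  assume forcing: "rainbow_forcing n r"
  have carrier: "carrier (integer_mod_group n) = {0..<int n}"
    using assms by (simp add: carrier_integer_mod_group)
  \<comment> \<open>The elements 0 to \<open>r - 1\<close> receive the colors 1 to \<open>r\<close>,
    and all later ones repeat \<open>r\<close>.\<close>
  define c where "c x = min (nat x + 1) r" for x :: int
  have cr: "c x \<in> {1..r}" for x using assms by (auto simp: c_def)
  have "i \<in> c ` {0..<int n}" if "i \<in> {1..r}" for i
    using that assms by (intro image_eqI[of _ _ "int i - 1"]) (auto simp: c_def)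
  then have "exact_coloring r (carrier (integer_mod_group n)) c"
    using cr unfolding exact_coloring_def carrier by blast
  then obtain x1 x2 x3 x4 where "distinct [c x1, c x2, c x3, c x4]"
    using forcing unfolding rainbow_forcing_def has_rainbow_solution_def by blast
  then show False using cr[of x1] cr[of x2] cr[of x3] cr[of x4] assms by auto
qed

theorem theorem1p1:
  fixes p :: nat
  assumes "prime p" and "p \<ge> 3"
  shows "rb_sidon p = 4"
proof (cases "p = 3")
  case True
  \<comment> \<open>Here 4 exceeds \<open>p\<close>, so the value 4 arises as \<open>p + 1\<close>
    from the convention.\<close>
  then have "\<not> (\<exists>r\<in>{1..p}. rainbow_forcing p r)" using not_rainbow_forcing_le_3 by auto
  then show ?thesis using True unfolding rb_sidon_def by simp
next
  case False
  then have "\<exists>r\<in>{1..p}. rainbow_forcing p r"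
    using rainbow_forcing_4[OF assms(1)] assms(2) by (intro bexI[of _ 4]) auto
  moreover have "(LEAST r. 1 \<le> r \<and> rainbow_forcing p r) = 4"
  proof (rule Least_equality)
    fix r assume "1 \<le> r \<and> rainbow_forcing p r"
    then show "4 \<le> r" using not_rainbow_forcing_le_3[of r p] assms(2) by force
  qed (use rainbow_forcing_4[OF assms(1)] in simp)
  ultimately show ?thesis unfolding rb_sidon_def by simp
qed

end
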